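(* For any integer $k$, and any $l>k$, there is a graph $G=(V,E)$ and an ordering $<$ of $V$ such that Maker wins the ordered vertex colouring game with $k$ colours on $G$ subject to $<$, whereas Breaker wins the ordered vertex colouring game on $G$ subject to $<$ with $l$ colours.
   Context: The ordered vertex colouring game is played on a finite simple graph $G=(V,E)$ with a fixed linear ordering $<$ of $V$ and a fixed finite palette $X$ of colours ("with $k$ colours" means $|X|=k$). Two players, Maker and Breaker, alternately colour the vertices of $V$ with colours from $X$, with Maker moving first; the vertices are coloured in the increasing order given by $<$ (so the player whose turn it is must colour the $<$-least uncoloured vertex, but is free to choose its colour). Either player may give a vertex $v$ the colour $c$ only if no neighbour of $v$ already has colour $c$. If at some point this is impossible to achieve (the next vertex cannot be given any colour), then Breaker wins. Otherwise the whole graph is eventually coloured, in which case Maker wins. Saying that a player "wins" the game means that this player has a winning strategy.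
   Formalization: The formal statement assumes k ≥ 2; for k = 0 or 1 the claim fails, since Maker winning with k colours forces the graph to be empty or edgeless, and then Breaker cannot win with l > k colours (negative k is meaningless). *)

theory Defs
  imports Main
begin

definition simple_graph :: "'v set \<Rightarrow> 'v set set \<Rightarrow> bool" where
  "simple_graph V E \<longleftrightarrow> finite V \<and> (\<forall>e\<in>E. e \<subseteq> V \<and> card e = 2)"

text \<open>Orderings are strict; \<open>strict_linear_order_on\<close> does not confine the relation to \<open>V\<close>.\<close>

definition vertex_ordering :: "'v set \<Rightarrow> 'v rel \<Rightarrow> bool" where
  "vertex_ordering V R \<longleftrightarrow> R \<subseteq> V \<times> V \<and> strict_linear_order_on V R"

datatype player = Maker | Breaker

text \<open>
  A position of the game is a partial colouring. As the vertices are coloured in a prescribed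
  order, the position determines the whole history of the play, so a strategy may be taken to be
  a function of the position.
\<close>

type_synonym ('v, 'c) position = "'v \<Rightarrow> 'c option"
type_synonym ('v, 'c) strategy = "('v, 'c) position \<Rightarrow> 'c"

definition to_move :: "('v, 'c) position \<Rightarrow> player" where
  "to_move p = (if even (card (dom p)) then Maker else Breaker)"

text \<open>Only meaningful as long as \<open>dom p \<noteq> V\<close>.\<close>

definition next_vertex :: "'v set \<Rightarrow> 'v rel \<Rightarrow> ('v, 'c) position \<Rightarrow> 'v" where
  "next_vertex V R p =
     (THE v. v \<in> V - dom p \<and> (\<forall>w \<in> V - dom p - {v}. (v, w) \<in> R))"

definition legal_colours ::
  "'v set \<Rightarrow> 'v set set \<Rightarrow> 'v rel \<Rightarrow> 'c set \<Rightarrow> ('v, 'c) position \<Rightarrow> 'c set" where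
  "legal_colours V E R X p =
     {x \<in> X. \<forall>w. {next_vertex V R p, w} \<in> E \<longrightarrow> p w \<noteq> Some x}"

definition game_over ::
  "'v set \<Rightarrow> 'v set set \<Rightarrow> 'v rel \<Rightarrow> 'c set \<Rightarrow> ('v, 'c) position \<Rightarrow> bool" where
  "game_over V E R X p \<longleftrightarrow> dom p = V \<or> legal_colours V E R X p = {}"

text \<open>The winner of a play, given the position in which it ended.\<close>

definition winner :: "'v set \<Rightarrow> ('v, 'c) position \<Rightarrow> player" where
  "winner V p = (if dom p = V then Maker else Breaker)"

text \<open>
  The positions that can arise when player \<open>P\<close> follows the strategy \<open>\<sigma>\<close> and the opponent makes
  arbitrary legal moves.
\<close>

inductive reachable ::
  "'v set \<Rightarrow> 'v set set \<Rightarrow> 'v rel \<Rightarrow> 'c set \<Rightarrow> player \<Rightarrow> ('v, 'c) strategy \<Rightarrow> ('v, 'c) position \<Rightarrow> bool"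
  for V E R X P \<sigma> where
  start: "reachable V E R X P \<sigma> Map.empty"
| move: "reachable V E R X P \<sigma> p \<Longrightarrow> \<not> game_over V E R X p \<Longrightarrow>
    x \<in> legal_colours V E R X p \<Longrightarrow> (to_move p = P \<Longrightarrow> x = \<sigma> p) \<Longrightarrow>
    reachable V E R X P \<sigma> (p(next_vertex V R p \<mapsto> x))"

text \<open>
  A winning strategy must never prescribe an illegal colour, and every play consistent with it must
  be won. Every play on a finite graph ends, so it suffices to look at final positions.
\<close>

definition winning_strategy ::
  "'v set \<Rightarrow> 'v set set \<Rightarrow> 'v rel \<Rightarrow> 'c set \<Rightarrow> player \<Rightarrow> ('v, 'c) strategy \<Rightarrow> bool" where
  "winning_strategy V E R X P \<sigma> \<longleftrightarrow>
     (\<forall>p. reachable V E R X P \<sigma> p \<longrightarrow>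
        (if game_over V E R X p then winner V p = P
         else to_move p = P \<longrightarrow> \<sigma> p \<in> legal_colours V E R X p))"

definition wins :: "player \<Rightarrow> 'v set \<Rightarrow> 'v set set \<Rightarrow> 'v rel \<Rightarrow> 'c set \<Rightarrow> bool" where
  "wins P V E R X \<longleftrightarrow> (\<exists>\<sigma>. winning_strategy V E R X P \<sigma>)"

subsection \<open>Fewer than two colours\<close>

lemma next_vertex_in:
  assumes V: "finite V" and ord: "vertex_ordering V R" and p: "dom p \<subseteq> V" "dom p \<noteq> V"
  shows "next_vertex V R p \<in> V - dom p"
proof -
  let ?A = "V - dom p"
  have tr: "trans R" and ir: "irrefl R" and tot: "total_on V R"
    using ord by (auto simp: vertex_ordering_def strict_linear_order_on_def)
  have "finite B \<Longrightarrow> B \<noteq> {} \<Longrightarrow> B \<subseteq> V \<Longrightarrow> \<exists>v\<in>B. \<forall>w\<in>B - {v}. (v, w) \<in> R" for B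
  proof (induction B rule: finite_ne_induct)
    case (singleton a)
    then show ?case by auto
  next
    case (insert a B)
    then obtain v where v: "v \<in> B" "\<forall>w\<in>B - {v}. (v, w) \<in> R" by auto
    have "a \<noteq> v" "a \<in> V" "v \<in> V" using insert v by auto
    then consider "(a, v) \<in> R" | "(v, a) \<in> R" using tot unfolding total_on_def by blast
    then show ?case
    proof cases
      case 1
      then have "\<forall>w\<in>insert a B - {a}. (a, w) \<in> R" using v tr unfolding trans_def by blast
      then show ?thesis by blast
    next
      case 2
      then have "\<forall>w\<in>insert a B - {v}. (v, w) \<in> R" using v by blast
      then show ?thesis using v by blast
    qed
  qed
  moreover have "finite ?A" "?A \<noteq> {}" "?A \<subseteq> V" using V p by auto
  ultimately obtain v where v: "v \<in> ?A" "\<forall>w\<in>?A - {v}. (v, w) \<in> R" by meson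
  have "next_vertex V R p = v" unfolding next_vertex_def
  proof (rule the_equality)
    show "v \<in> ?A \<and> (\<forall>w\<in>?A - {v}. (v, w) \<in> R)" using v by blast
    fix u assume u: "u \<in> ?A \<and> (\<forall>w\<in>?A - {u}. (u, w) \<in> R)"
    show "u = v"
    proof (rule ccontr)
      assume "u \<noteq> v"
      then have "(u, v) \<in> R" "(v, u) \<in> R" using u v by blast+
      then show False using tr ir unfolding trans_def irrefl_def by blast
    qed
  qed
  then show ?thesis using v by simp
qed

lemma reachable_proper:
  assumes G: "simple_graph V E" and ord: "vertex_ordering V R"
    and r: "reachable V E R X P \<sigma> p"
  shows "dom p \<subseteq> V" "ran p \<subseteq> X" "\<And>u w x. {u, w} \<in> E \<Longrightarrow> p u = Some x \<Longrightarrow> p w \<noteq> Some x"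
proof -
  have fV: "finite V" and E2: "\<And>u w. {u, w} \<in> E \<Longrightarrow> u \<noteq> w"
    using G by (force simp: simple_graph_def)+
  have "dom p \<subseteq> V \<and> ran p \<subseteq> X \<and> (\<forall>u w x. {u, w} \<in> E \<longrightarrow> p u = Some x \<longrightarrow> p w \<noteq> Some x)"
    using r
  proof induction
    case start
    then show ?case by simp
  next
    case (move p x)
    let ?v = "next_vertex V R p"
    have v: "?v \<in> V - dom p"
      using next_vertex_in[OF fV ord] move by (auto simp: game_over_def)
    have x: "x \<in> X" "\<And>w. {?v, w} \<in> E \<Longrightarrow> p w \<noteq> Some x"
      using move.hyps(3) by (auto simp: legal_colours_def)
    have "(p(?v \<mapsto> x)) w \<noteq> Some y" if "{u, w} \<in> E" "(p(?v \<mapsto> x)) u = Some y" for u w y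
    proof -
      have "{w, u} \<in> E" using that(1) by (simp add: insert_commute)
      then show ?thesis
        using that E2[OF that(1)] x(2)[of u] x(2)[of w] move.IH
        by (auto split: if_splits)
    qed
    moreover have "dom (p(?v \<mapsto> x)) \<subseteq> V" using move.IH v by auto
    moreover have "ran (p(?v \<mapsto> x)) \<subseteq> X" using move.IH v x(1) by (auto simp: ran_def)
    ultimately show ?case by blast
  qed
  then show "dom p \<subseteq> V" "ran p \<subseteq> X" "\<And>u w x. {u, w} \<in> E \<Longrightarrow> p u = Some x \<Longrightarrow> p w \<noteq> Some x"
    by blast+
qed

lemma winning_strategy_final:
  assumes G: "simple_graph V E" and ord: "vertex_ordering V R"
    and win: "winning_strategy V E R X P \<sigma>"
  obtains p where "reachable V E R X P \<sigma> p" "game_over V E R X p" "winner V p = P"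
proof -
  have fV: "finite V" using G by (simp add: simple_graph_def)
  have "\<exists>q. reachable V E R X P \<sigma> q \<and> game_over V E R X q"
    if "reachable V E R X P \<sigma> p" for p
    using that
  proof (induction "card (V - dom p)" arbitrary: p rule: less_induct)
    case less
    show ?case
    proof (cases "game_over V E R X p")
      case True
      then show ?thesis using less.prems by blast
    next
      case False
      let ?v = "next_vertex V R p"
      have v: "?v \<in> V - dom p"
        using next_vertex_in[OF fV ord reachable_proper(1)[OF G ord less.prems]] False
        by (auto simp: game_over_def)
      obtain x where x: "x \<in> legal_colours V E R X p" "to_move p = P \<Longrightarrow> x = \<sigma> p"
        using False win less.prems unfolding winning_strategy_def game_over_def by (metis ex_in_conv)
      have "reachable V E R X P \<sigma> (p(?v \<mapsto> x))"
        using reachable.move[OF less.prems False x] .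
      moreover have "card (V - dom (p(?v \<mapsto> x))) < card (V - dom p)"
        by (rule psubset_card_mono) (use fV v in auto)
      ultimately show ?thesis using less.hyps by blast
    qed
  qed
  then obtain q where "reachable V E R X P \<sigma> q" "game_over V E R X q"
    using reachable.start by metis
  then show thesis using win that unfolding winning_strategy_def by metis
qed

text \<open>
  With fewer than two colours Maker only wins on edgeless graphs, and there Breaker does not win
  with any larger palette. Non-monotonicity in the number of colours is thus only possible from two
  colours on.
\<close>

lemma few_colours_monotone:
  assumes G: "simple_graph V E" and ord: "vertex_ordering V R"
    and X: "finite X" "card X < 2" and Y: "card X < card Y"
    and win: "wins Maker V E R X"
  shows "\<not> wins Breaker V E R Y"
proof
  assume "wins Breaker V E R Y"
  then obtain \<tau> q where q: "reachable V E R Y Breaker \<tau> q"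
      "game_over V E R Y q" "winner V q = Breaker"
    unfolding wins_def by (meson winning_strategy_final[OF G ord])
  obtain \<sigma> p where p: "reachable V E R X Maker \<sigma> p"
      "game_over V E R X p" "winner V p = Maker"
    using win unfolding wins_def by (meson winning_strategy_final[OF G ord])
  have dom: "dom p = V" using p(3) by (auto simp: winner_def split: if_splits)
  have "E = {}"
  proof (rule ccontr)
    assume "E \<noteq> {}"
    then obtain e where e: "e \<in> E" by blast
    then obtain u w where uw: "e = {u, w}" "u \<noteq> w" "{u, w} \<subseteq> V"
      using G unfolding simple_graph_def by (metis card_2_iff)
    then obtain x y where xy: "p u = Some x" "p w = Some y" using dom by blast
    have "x \<in> X" "y \<in> X" using xy reachable_proper(2)[OF G ord p(1)] by (auto simp: ran_def)
    then have "x = y" using X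
      by (metis One_nat_def card_le_Suc0_iff_eq less_2_cases_iff order.refl zero_le)
    then show False using reachable_proper(3)[OF G ord p(1)] e uw xy by blast
  qed
  then have "legal_colours V E R Y q = Y" by (simp add: legal_colours_def)
  moreover have "Y \<noteq> {}" using Y by auto
  ultimately show False using q by (auto simp: game_over_def winner_def split: if_splits)
qed

end

theory Submission imports Defs "HOL-Combinatorics.Transposition" begin

text \<open>
  The graph is built so that Breaker colours everything that matters. All edges join odd numbers
  and the vertices are coloured in their natural order \<open>0, 1, 2, \<dots>\<close>, so Maker, who moves at the
  even numbers, only ever colours isolated vertices. The theorem thus becomes a statement about
  one ordered graph \<open>H\<close>: colouring \<open>H\<close> vertex by vertex with \<open>k\<close> colours never gets stuck,
  whatever choices are made, while with \<open>l\<close> colours some sequence of choices does get stuck.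

  The first property is ensured by rigidity. The graph \<open>H\<close> is \<open>k\<close>-partite, begins with a
  \<open>k\<close>-clique that has one vertex in each class, and every later vertex has earlier neighbours in all
  classes but its own. The clique uses up all \<open>k\<close> colours, after which the colour of each vertex is
  forced to be the colour of its class, and this colour is always available
  (\<open>maker_wins_if_rigid\<close>).

  For the second property, \<open>H\<close> has a further colouring, with \<open>l\<close> colours and defined on all
  vertices but the last, under which the neighbours of the last vertex show every colour. Breaker
  simply plays this colouring (\<open>breaker_wins_if_blocking\<close>).

  The two colourings, the class \<open>cls\<close> and Breaker's colour \<open>col\<close>, are in fact all there is to
  \<open>H\<close>: two vertices are adjacent as soon as both colourings tell them apart. The last vertex gets an
  extra colour \<open>l\<close> in \<open>col\<close>, so it is adjacent to everything outside its class, which is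
  \<open>k - 2\<close>. Its neighbours in the initial clique and the vertices \<open>k, \<dots>, l - 1\<close> of class
  \<open>k - 1\<close> show all colours but \<open>k - 2\<close>, which Breaker still has to bring into another class. The surplus colour \<open>k < l\<close> makes this possible: vertex \<open>l\<close> lies in class \<open>k - 2\<close> but
  is coloured \<open>k\<close>, and so vertex \<open>l + 1\<close> of class \<open>k - 1\<close>, which is not adjacent to
  \<open>k - 2\<close>, can be coloured \<open>k - 2\<close> and still has a neighbour in class \<open>k - 2\<close>.
\<close>

section \<open>Graphs in natural order with all edges on Breaker's turns\<close>

definition natural_order :: "nat \<Rightarrow> nat rel" where
  "natural_order N = {(u, v). u < v \<and> v < N}"

definition odd_edges :: "nat \<Rightarrow> (nat \<Rightarrow> nat \<Rightarrow> bool) \<Rightarrow> nat set set" where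
  "odd_edges m adj = {{2 * i + 1, 2 * j + 1} | i j. i < m \<and> j < m \<and> adj i j}"

lemma vertex_ordering_natural_order: "vertex_ordering {..<N} (natural_order N)"
  by (auto simp: vertex_ordering_def natural_order_def strict_linear_order_on_def
      trans_def irrefl_def total_on_def)

lemma simple_graph_odd_edges:
  assumes "irreflp adj"
  shows "simple_graph {..<2 * m} (odd_edges m adj)"
proof -
  have "card {2 * i + 1, 2 * j + 1} = 2" if "adj i j" for i j
    using assms that by (cases "i = j") (auto simp: irreflp_def)
  then show ?thesis by (auto simp: simple_graph_def odd_edges_def)
qed

lemma next_vertex_natural_order:
  assumes "dom p = {..<n}" "n < N"
  shows "next_vertex {..<N} (natural_order N) p = n"
  unfolding next_vertex_def
proof (rule the_equality)
  show "n \<in> {..<N} - dom p \<and> (\<forall>w\<in>{..<N} - dom p - {n}. (n, w) \<in> natural_order N)"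
    using assms by (auto simp: natural_order_def)
next
  fix v assume v: "v \<in> {..<N} - dom p \<and> (\<forall>w\<in>{..<N} - dom p - {v}. (v, w) \<in> natural_order N)"
  show "v = n"
  proof (rule ccontr)
    assume "v \<noteq> n"
    then have "(v, n) \<in> natural_order N" using v assms by auto
    then show False using v assms by (auto simp: natural_order_def)
  qed
qed

lemma legal_colours_even:
  assumes "dom p = {..<n}" "n < 2 * m" "even n"
  shows "legal_colours {..<2 * m} (odd_edges m adj) (natural_order (2 * m)) X p = X"
proof -
  have "{n, w} \<notin> odd_edges m adj" for w
    using assms(3) by (auto simp: odd_edges_def doubleton_eq_iff)
  then show ?thesis using assms by (simp add: legal_colours_def next_vertex_natural_order)
qed

lemma legal_colours_odd:
  assumes "dom p = {..<2 * i + 1}" "i < m" "symp adj"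
  shows "legal_colours {..<2 * m} (odd_edges m adj) (natural_order (2 * m)) X p =
           {x \<in> X. \<forall>j<i. adj j i \<longrightarrow> p (2 * j + 1) \<noteq> Some x}"
proof -
  have nv: "next_vertex {..<2 * m} (natural_order (2 * m)) p = 2 * i + 1"
    using assms by (intro next_vertex_natural_order) auto
  have edge: "{2 * i + 1, w} \<in> odd_edges m adj \<longleftrightarrow> (\<exists>j<m. w = 2 * j + 1 \<and> adj j i)" for w
    using assms(2,3) by (auto simp: odd_edges_def doubleton_eq_iff symp_def)
  have uncoloured: "p (2 * j + 1) = None" if "\<not> j < i" for j
  proof -
    have "2 * j + 1 \<notin> dom p" using that assms(1) by simp
    then show ?thesis by (simp add: domIff)
  qed
  have "(\<forall>w. {2 * i + 1, w} \<in> odd_edges m adj \<longrightarrow> p w \<noteq> Some x) \<longleftrightarrow>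
        (\<forall>j<i. adj j i \<longrightarrow> p (2 * j + 1) \<noteq> Some x)" for x
    unfolding edge using uncoloured assms(2)
    by (metis less_trans option.distinct(1))
  then show ?thesis by (simp add: legal_colours_def nv)
qed

lemma reachable_natural_order:
  assumes "reachable {..<N} E (natural_order N) X P \<sigma> p"
  shows "\<exists>n\<le>N. dom p = {..<n}"
  using assms
proof induction
  case start
  show ?case by (auto intro: exI[of _ 0])
next
  case (move p x)
  then obtain n where n: "n \<le> N" "dom p = {..<n}" by blast
  with move have "n < N" by (auto simp: game_over_def order_less_le)
  moreover from n this have "dom (p(next_vertex {..<N} (natural_order N) p \<mapsto> x)) = {..<Suc n}"
    by (simp add: next_vertex_natural_order lessThan_Suc)
  ultimately show ?case using Suc_leI by blast
qed

section \<open>Maker wins when the number of colours equals the number of classes\<close>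

text \<open>
  For \<open>i < k\<close> the last hypothesis makes vertex \<open>i\<close> adjacent to all earlier vertices, and for
  \<open>i \<ge> k\<close> it gives \<open>i\<close> earlier neighbours in all classes but its own. In the proof, \<open>f\<close> assigns
  colours to classes, as far as the play has determined them. The colour that \<open>f\<close> assigns to the
  class of the next vertex is always available. A player can choose another colour only in the
  initial clique, and there a colour that no class has used yet, so it suffices to swap two values
  of \<open>f\<close> that the play has not determined.
\<close>

lemma maker_wins_if_rigid:
  fixes cls :: "nat \<Rightarrow> nat"
  assumes X: "finite X" "card X = k"
    and sym: "symp adj"
    and cls: "\<And>i. i < m \<Longrightarrow> cls i < k"
    and proper: "\<And>i j. adj i j \<Longrightarrow> cls i \<noteq> cls j"
    and rep: "\<And>i. i < k \<Longrightarrow> cls i = i"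
    and sees: "\<And>c i. i < m \<Longrightarrow> c < k \<Longrightarrow> c < i \<Longrightarrow> c \<noteq> cls i \<Longrightarrow> \<exists>j<i. adj j i \<and> cls j = c"
  shows "wins Maker {..<2 * m} (odd_edges m adj) (natural_order (2 * m)) X"
proof -
  let ?V = "{..<2 * m}" and ?E = "odd_edges m adj" and ?R = "natural_order (2 * m)"
  let ?legal = "legal_colours ?V ?E ?R X"
  define follows where "follows p f \<longleftrightarrow> bij_betw f {..<k} X \<and>
      (\<forall>j. 2 * j + 1 \<in> dom p \<longrightarrow> p (2 * j + 1) = Some (f (cls j)))" for p f
  have available: "f (cls i) \<in> ?legal p"
    if "dom p = {..<2 * i + 1}" "i < m" "follows p f" for p f i
  proof -
    have "p (2 * j + 1) \<noteq> Some (f (cls i))" if "j < i" "adj j i" for j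
    proof -
      have "p (2 * j + 1) = Some (f (cls j))"
        using \<open>follows p f\<close> \<open>dom p = _\<close> that unfolding follows_def by simp
      moreover have "f (cls j) \<noteq> f (cls i)"
        using \<open>follows p f\<close> cls[of j] cls[of i] proper[of j i] that \<open>i < m\<close>
        by (auto simp: follows_def bij_betw_def inj_on_def)
      ultimately show ?thesis by simp
    qed
    moreover have "f (cls i) \<in> X"
      using that cls by (auto simp: follows_def bij_betw_def)
    ultimately show ?thesis using legal_colours_odd[OF that(1,2) sym] by auto
  qed
  have preserved: "\<exists>f. follows (p(2 * i + 1 \<mapsto> x)) f"
    if dom: "dom p = {..<2 * i + 1}" and i: "i < m" and f: "follows p f" and x: "x \<in> ?legal p"
    for p f i x
  proof -
    have bij: "bij_betw f {..<k} X" and pf: "\<And>j. j < i \<Longrightarrow> p (2 * j + 1) = Some (f (cls j))"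
      using f dom by (auto simp: follows_def)
    have x': "x \<in> X" "\<And>j. j < i \<Longrightarrow> adj j i \<Longrightarrow> p (2 * j + 1) \<noteq> Some x"
      using x legal_colours_odd[OF dom i sym] by auto
    obtain c where c: "c < k" "x = f c"
      using bij x'(1) by (auto simp: bij_betw_def)
    show ?thesis
    proof (cases "c = cls i")
      case True
      then have "follows (p(2 * i + 1 \<mapsto> x)) f" using f c by (auto simp: follows_def)
      then show ?thesis by blast
    next
      case False
      have "\<not> c < i" using sees[OF i c(1) _ False] x'(2) pf c(2) by metis
      then have i': "i < k" "cls i = i" "i < c" using c(1) rep[of i] False by auto
      let ?f = "f \<circ> transpose i c"
      have "bij_betw ?f {..<k} X"
        using i'(1) c(1) bij by (intro bij_betw_trans[where B = "{..<k}"]) simp_all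
      moreover have "?f (cls j) = f (cls j)" if "j < i" for j
        using that i' rep[of j] by (simp add: transpose_def)
      ultimately have "follows (p(2 * i + 1 \<mapsto> x)) ?f"
        using pf i'(2) c(2) dom by (auto simp: follows_def)
      then show ?thesis by blast
    qed
  qed
  have invariant: "\<exists>f. follows p f" if "reachable ?V ?E ?R X P \<sigma> p" for P \<sigma> p
    using that
  proof induction
    case start
    have "\<exists>f. bij_betw f {..<k} X" using X by (simp add: bij_betw_iff_card)
    then show ?case by (auto simp: follows_def)
  next
    case (move p x)
    then obtain f where f: "follows p f" by blast
    obtain n where n: "n \<le> 2 * m" "dom p = {..<n}"
      using reachable_natural_order move.hyps(1) by blast
    then have less: "n < 2 * m" using move.hyps(2) by (auto simp: game_over_def order_less_le)
    have nv: "next_vertex ?V ?R p = n" using n less by (simp add: next_vertex_natural_order)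
    show ?case
    proof (cases "even n")
      case True
      then have "follows (p(n \<mapsto> x)) f" using f by (auto simp: follows_def)
      then show ?thesis unfolding nv by blast
    next
      case False
      then obtain i where "n = 2 * i + 1" by (auto elim: oddE)
      then show ?thesis using preserved[of p i f x] n(2) less f move.hyps(3)
        by (simp add: nv del: fun_upd_apply)
    qed
  qed
  have not_stuck: "?legal p \<noteq> {}" if r: "reachable ?V ?E ?R X P \<sigma> p" and "dom p \<noteq> ?V" for P \<sigma> p
  proof -
    obtain n where n: "n \<le> 2 * m" "dom p = {..<n}"
      using reachable_natural_order r by blast
    then have less: "n < 2 * m" using that(2) by (auto simp: order_less_le)
    show ?thesis
    proof (cases "even n")
      case True
      then have "?legal p = X" using n less by (simp add: legal_colours_even)
      moreover have "X \<noteq> {}" using cls[of 0] X less by auto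
      ultimately show ?thesis by simp
    next
      case False
      then obtain i where i: "n = 2 * i + 1" by (auto elim: oddE)
      obtain f where "follows p f" using invariant[OF r] by blast
      then show ?thesis using available[of p i f] n(2) less i by auto
    qed
  qed
  let ?\<sigma> = "\<lambda>p. SOME x. x \<in> ?legal p"
  have "winning_strategy ?V ?E ?R X Maker ?\<sigma>"
    unfolding winning_strategy_def game_over_def winner_def some_in_eq
    using not_stuck by meson
  then show ?thesis unfolding wins_def by blast
qed

section \<open>Breaker wins when some partial colouring blocks a vertex\<close>

text \<open>
  Maker never colours an odd vertex, so nothing stops Breaker from reproducing \<open>g\<close> up to
  vertex \<open>z\<close>, which then cannot be coloured.
\<close>

lemma breaker_wins_if_blocking:
  assumes sym: "symp adj" and z: "z < m"
    and range: "\<And>i. i < z \<Longrightarrow> g i \<in> Y"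
    and proper: "\<And>i j. i < z \<Longrightarrow> j < z \<Longrightarrow> adj i j \<Longrightarrow> g i \<noteq> g j"
    and blocks: "\<And>y. y \<in> Y \<Longrightarrow> \<exists>i<z. adj i z \<and> g i = y"
  shows "wins Breaker {..<2 * m} (odd_edges m adj) (natural_order (2 * m)) Y"
proof -
  let ?V = "{..<2 * m}" and ?E = "odd_edges m adj" and ?R = "natural_order (2 * m)"
  \<comment> \<open>The next vertex is \<open>card (dom p)\<close>; if Breaker is to move, it is odd and halving it gives its
    position among the odd numbers.\<close>
  let ?\<sigma> = "\<lambda>p. g (card (dom p) div 2)"
  have invariant: "\<exists>n\<le>2 * z + 1. dom p = {..<n} \<and> (\<forall>i. 2 * i + 1 < n \<longrightarrow> p (2 * i + 1) = Some (g i))"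
    if "reachable ?V ?E ?R Y Breaker ?\<sigma> p" for p
    using that
  proof induction
    case start
    show ?case by (auto intro: exI[of _ 0])
  next
    case (move p x)
    then obtain n where n: "n \<le> 2 * z + 1" "dom p = {..<n}"
      and p: "\<And>i. 2 * i + 1 < n \<Longrightarrow> p (2 * i + 1) = Some (g i)" by blast
    have nv: "next_vertex ?V ?R p = n" using n z by (simp add: next_vertex_natural_order)
    have "n \<noteq> 2 * z + 1"
    proof
      assume eq: "n = 2 * z + 1"
      have "legal_colours ?V ?E ?R Y p = {}"
        using legal_colours_odd[OF n(2)[unfolded eq] z sym] p blocks eq by force
      then show False using move.hyps(2) by (simp add: game_over_def)
    qed
    moreover have "(p(n \<mapsto> x)) (2 * i + 1) = Some (g i)" if i: "2 * i + 1 < Suc n" for i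
    proof (cases "2 * i + 1 = n")
      case True
      then have "to_move p = Breaker" "?\<sigma> p = g i" using n(2) by (auto simp: to_move_def)
      then show ?thesis using move.hyps(4) True by simp
    qed (use p i in auto)
    moreover have "dom (p(n \<mapsto> x)) = {..<Suc n}" using n(2) by (simp add: lessThan_Suc)
    ultimately show ?case using n(1) unfolding nv by (intro exI[of _ "Suc n"]) (simp del: fun_upd_apply dom_fun_upd)
  qed
  have "winning_strategy ?V ?E ?R Y Breaker ?\<sigma>"
    unfolding winning_strategy_def
  proof (intro allI impI)
    fix p assume "reachable ?V ?E ?R Y Breaker ?\<sigma> p"
    then obtain n where n: "n \<le> 2 * z + 1" "dom p = {..<n}"
      and p: "\<And>i. 2 * i + 1 < n \<Longrightarrow> p (2 * i + 1) = Some (g i)" using invariant by blast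
    have unfinished: "dom p \<noteq> ?V" using n z by auto
    show "if game_over ?V ?E ?R Y p then winner ?V p = Breaker
          else to_move p = Breaker \<longrightarrow> ?\<sigma> p \<in> legal_colours ?V ?E ?R Y p"
    proof (cases "game_over ?V ?E ?R Y p")
      case True
      then show ?thesis using unfinished by (simp add: winner_def)
    next
      case False
      have "?\<sigma> p \<in> legal_colours ?V ?E ?R Y p" if "to_move p = Breaker"
      proof -
        have "odd n" using that n(2) by (auto simp: to_move_def split: if_splits)
        then obtain i where i: "n = 2 * i + 1" by (auto elim: oddE)
        have legal: "legal_colours ?V ?E ?R Y p =
            {y \<in> Y. \<forall>j<i. adj j i \<longrightarrow> p (2 * j + 1) \<noteq> Some y}"
          using legal_colours_odd[of p i m adj Y] n i z sym by simp
        have "i \<noteq> z"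
        proof
          assume "i = z"
          then have "legal_colours ?V ?E ?R Y p = {}" using legal p blocks i by force
          then show False using False by (simp add: game_over_def)
        qed
        then have "i < z" using n(1) i by simp
        then show ?thesis using n(2) i range[of i] proper[of _ i] p unfolding legal by auto
      qed
      then show ?thesis using False by simp
    qed
  qed
  then show ?thesis unfolding wins_def by blast
qed

section \<open>The graph\<close>

definition cls :: "nat \<Rightarrow> nat \<Rightarrow> nat \<Rightarrow> nat" where
  "cls k l i = (if i < k then i else if i = l \<or> i = l + 2 then k - 2 else k - 1)"

definition col :: "nat \<Rightarrow> nat \<Rightarrow> nat \<Rightarrow> nat" where
  "col k l i = (if i < l then i else if i = l then k else if i = l + 1 then k - 2 else l)"

definition separated :: "nat \<Rightarrow> nat \<Rightarrow> nat \<Rightarrow> nat \<Rightarrow> bool" where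
  "separated k l i j \<longleftrightarrow> cls k l i \<noteq> cls k l j \<and> col k l i \<noteq> col k l j"

lemma symp_separated: "symp (separated k l)"
  by (auto simp: symp_def separated_def)

text \<open>
  The clique vertex \<open>c\<close> represents its class for every later vertex, except that vertex \<open>l + 1\<close>,
  coloured \<open>k - 2\<close> by Breaker, has to rely on \<open>l\<close> instead of \<open>k - 2\<close>.
\<close>

lemma separated_sees_other_classes:
  assumes "2 \<le> k" "k < l" "i < l + 3" "c < k" "c < i" "c \<noteq> cls k l i"
  shows "\<exists>j<i. separated k l j i \<and> cls k l j = c"
proof (cases "i = l + 1 \<and> c = k - 2")
  case True
  then show ?thesis
    using assms by (intro exI[of _ l]) (auto simp: separated_def cls_def col_def)
next
  case False
  then have "col k l c \<noteq> col k l i" using assms by (auto simp: col_def)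
  then show ?thesis
    using assms by (intro exI[of _ c]) (auto simp: separated_def cls_def)
qed

lemma last_vertex_blocked:
  assumes "2 \<le> k" "k < l" "y < l"
  shows "\<exists>i<l + 2. separated k l i (l + 2) \<and> col k l i = y"
proof (cases "y = k - 2")
  case True
  then show ?thesis
    using assms by (intro exI[of _ "l + 1"]) (auto simp: separated_def cls_def col_def)
next
  case False
  then show ?thesis
    using assms by (intro exI[of _ y]) (auto simp: separated_def cls_def col_def)
qed

theorem theorem1p4:
  fixes k l :: nat
  assumes "2 \<le> k" and "k < l"
  shows "\<exists>(V :: nat set) (E :: nat set set) (R :: nat rel).
           simple_graph V E \<and> vertex_ordering V R \<and>
           (\<forall>X :: nat set. finite X \<and> card X = k \<longrightarrow> wins Maker V E R X) \<and>
           (\<forall>Y :: nat set. finite Y \<and> card Y = l \<longrightarrow> wins Breaker V E R Y)"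
proof -
  let ?m = "l + 3"
  let ?V = "{..<2 * ?m}" and ?E = "odd_edges ?m (separated k l)" and ?R = "natural_order (2 * ?m)"
  have "simple_graph ?V ?E"
    by (rule simple_graph_odd_edges) (simp add: irreflp_def separated_def)
  moreover have "vertex_ordering ?V ?R" by (rule vertex_ordering_natural_order)
  moreover have "wins Maker ?V ?E ?R X" if "finite X" "card X = k" for X :: "nat set"
  proof (rule maker_wins_if_rigid[where cls = "cls k l"])
    show "cls k l i < k" for i using assms by (auto simp: cls_def)
  qed (use that assms symp_separated separated_sees_other_classes
      in \<open>auto simp: separated_def cls_def\<close>)
  moreover have "wins Breaker ?V ?E ?R Y" if Y: "finite Y" "card Y = l" for Y :: "nat set"
  proof -
    obtain h where h: "bij_betw h {..<l} Y"
      using Y by (metis bij_betw_iff_card card_lessThan finite_lessThan)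
    have col: "col k l i < l" if "i < l + 2" for i using that assms by (auto simp: col_def)
    show ?thesis
    proof (rule breaker_wins_if_blocking[where z = "l + 2" and g = "h \<circ> col k l"])
      show "\<exists>i<l + 2. separated k l i (l + 2) \<and> (h \<circ> col k l) i = y" if y: "y \<in> Y" for y
      proof -
        obtain c where "c < l" "y = h c" using h y by (auto simp: bij_betw_def)
        then show ?thesis using last_vertex_blocked[OF assms] by force
      qed
      show "(h \<circ> col k l) i \<noteq> (h \<circ> col k l) j"
        if "i < l + 2" "j < l + 2" "separated k l i j" for i j
        using h that col by (auto simp: separated_def bij_betw_def inj_on_def)
      show "(h \<circ> col k l) i \<in> Y" if "i < l + 2" for i
        using h col[OF that] by (auto simp: bij_betw_def)
    qed (use symp_separated in auto)
  qed
  ultimately show ?thesis by blast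
qed

end
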